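(* Let $d\ge 1$ and let $X,Y\subseteq\mathbb{T}_{\pm}^d$ be nonempty and disjoint TO-convex sets. Then there exists a signed tropical hyperplane $\mathcal{H}(a)$ (that is, a vector $a=(a_0,\dots,a_d)\in\mathbb{T}_{\pm}^{d+1}$ with $(a_1,\dots,a_d)\neq(\mathbb{O},\dots,\mathbb{O})$) such that $X\subseteq\overline{\mathcal{H}}^+(a)$ and $Y\subseteq\overline{\mathcal{H}}^-(a)$.
   Context: Signed tropical numbers. Let $\mathbb{O}=-\infty$ be the tropical zero. $\mathbb{T}_{>\mathbb{O}}=\mathbb{R}$ (positive numbers), $\mathbb{T}_{<\mathbb{O}}=\{\ominus r: r\in\mathbb{R}\}$ (negative numbers), $\mathbb{T}_{\ge\mathbb{O}}=\mathbb{R}\cup\{\mathbb{O}\}$, $\mathbb{T}_{\pm}=\mathbb{T}_{>\mathbb{O}}\cup\mathbb{T}_{<\mathbb{O}}\cup\{\mathbb{O}\}$, balanced numbers $\mathbb{T}_{\bullet}=\{\bullet r: r\in\mathbb{R}\}\cup\{\mathbb{O}\}$, symmetrized semiring $\mathbb{S}=\mathbb{T}_{\pm}\cup\mathbb{T}_{\bullet}$. The norm is $|r|=|\ominus r|=|\bullet r|=r$ and $|\mathbb{O}|=\mathbb{O}$; the sign $\mathrm{tsgn}$ takes values in $\{\oplus,\ominus,\bullet,\mathbb{O}\}$. Addition on $\mathbb{S}$: $x\oplus y$ equals $x$ if $|x|>|y|$, $y$ if $|y|>|x|$, $x$ if $|x|=|y|$ and $\mathrm{tsgn}(x)=\mathrm{tsgn}(y)$,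 and $\bullet|x|$ if $|x|=|y|$ and the signs differ. Multiplication: $x\odot y$ has norm $|x|+|y|$ and sign the product of signs (with $\oplus,\ominus,\bullet$ multiplying like $1,-1,0$); $\mathbb{O}$ is absorbing. The multiplicative unit is the real number $0$. Operations extend to vectors and matrices in the usual way. Order on $\mathbb{T}_{\pm}$: $x>y$ iff $x\oplus(\ominus y)\in\mathbb{T}_{>\mathbb{O}}$ (a total order). Hyperplanes and halfspaces. For $a=(a_0,\dots,a_d)\in\mathbb{T}_{\pm}^{d+1}$ with $(a_1,\dots,a_d)\ne(\mathbb{O},\dots,\mathbb{O})$, write $a(x)=a_0\oplus a_1\odot x_1\oplus\dots\oplus a_d\odot x_d$. Then $\mathcal{H}(a)=\{x\in\mathbb{T}_{\pm}^d: a(x)\in\mathbb{T}_{\bullet}\}$, $\overline{\mathcal{H}}^+(a)=\{x\in\mathbb{T}_{\pm}^d: a(x)\in\mathbb{T}_{>\mathbb{O}}\cup\mathbb{T}_{\bullet}\}$ and $\overline{\mathcal{H}}^-(a)=\overline{\mathcal{H}}^+(\ominus a)$. TO-convexity. For $s\in\mathbb{S}$, $\mathcal{U}(s)=\{x\in\mathbb{T}_{\pm}:\ominus|s|\le x\le|s|\}$ if $s\in\mathbb{T}_{\bullet}$ and $\mathcal{U}(s)=\{s\}$ otherwise; for vectors $\mathcal{U}(s)=\prod_i\mathcal{U}(s_i)$. For a finite set $T=\{v_1,\dots,v_n\}\subseteq\mathbb{T}_{\pm}^d$, $\mathrm{conv}_{TO}(T)=\bigcup\{\mathcal{U}(\lambda_1\odot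 v_1\oplus\dots\oplus\lambda_n\odot v_n):\lambda_i\in\mathbb{T}_{\ge\mathbb{O}},\ \bigoplus_i\lambda_i=0\}$. A set $M\subseteq\mathbb{T}_{\pm}^d$ is TO-convex if $\mathrm{conv}_{TO}(T)\subseteq M$ for all finite $T\subseteq M$. *)

theory Defs
  imports "HOL-Analysis.Analysis"
begin

datatype tsign = Plus | Minus | Balanced

text \<open>
  The symmetrized tropical semiring \<open>\<S>\<close>: \<open>TZero\<close> is the tropical zero \<open>-\<infinity>\<close>, and
  \<open>TNum s r\<close> is the element with sign \<open>s\<close> and norm \<open>r\<close>. The tropical operations are
  \<open>+\<close> and \<open>*\<close> of the semiring class below, so \<open>0 :: symtrop\<close> is the tropical zero and
  \<open>1 :: symtrop\<close> is the positive number \<open>TNum Plus 0\<close>.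
\<close>

datatype symtrop = TZero | TNum tsign real

fun sign_mult :: "tsign \<Rightarrow> tsign \<Rightarrow> tsign" where
  "sign_mult Plus t = t"
| "sign_mult s Plus = s"
| "sign_mult Minus Minus = Plus"
| "sign_mult _ _ = Balanced"

instantiation symtrop :: "{zero, one, plus, times, uminus}"
begin

definition zero_symtrop :: symtrop where "0 = TZero"

definition one_symtrop :: symtrop where "1 = TNum Plus 0"

fun plus_symtrop :: "symtrop \<Rightarrow> symtrop \<Rightarrow> symtrop" where
  "TZero + y = y"
| "x + TZero = x"
| "TNum s p + TNum t q =
     (if q < p then TNum s p
      else if p < q then TNum t q
      else if s = t then TNum s p
      else TNum Balanced p)"

fun times_symtrop :: "symtrop \<Rightarrow> symtrop \<Rightarrow> symtrop" where
  "TNum s p * TNum t q = TNum (sign_mult s t) (p + q)"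
| "TZero * y = TZero"
| "x * TZero = TZero"

text \<open>Unary minus is \<open>\<ominus>\<close>. It is not an additive inverse: \<open>x + - x\<close> is balanced.\<close>

fun uminus_symtrop :: "symtrop \<Rightarrow> symtrop" where
  "- TZero = TZero"
| "- TNum s r = TNum (sign_mult Minus s) r"

instance ..

end

lemma sign_mult_commute: "sign_mult s t = sign_mult t s"
  by (cases s; cases t) simp_all

lemma sign_mult_assoc: "sign_mult (sign_mult s t) u = sign_mult s (sign_mult t u)"
  by (cases s; cases t; cases u) simp_all

lemma sign_mult_Balanced [simp]:
  "sign_mult s Balanced = Balanced" "sign_mult Balanced s = Balanced"
  by (cases s; simp)+

instance symtrop :: comm_semiring_1
proof
  fix a b c :: symtrop
  show "a * b * c = a * (b * c)"
    by (cases a; cases b; cases c) (simp_all add: sign_mult_assoc)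
  show "a * b = b * a"
    by (cases a; cases b) (simp_all add: sign_mult_commute)
  show "1 * a = a"
    by (cases a) (simp_all add: one_symtrop_def)
  show "a + b + c = a + (b + c)"
    by (cases a; cases b; cases c) auto
  show "a + b = b + a"
    by (cases a; cases b) auto
  show "0 + a = a"
    by (simp add: zero_symtrop_def)
  show "(a + b) * c = a * c + b * c"
  proof (cases "a = TZero \<or> b = TZero \<or> c = TZero")
    case True
    then show ?thesis by (cases a; cases b; cases c) auto
  next
    case False
    then obtain s p t q u r where "a = TNum s p" "b = TNum t q" "c = TNum u r"
      by (metis symtrop.exhaust)
    then show ?thesis by (cases s; cases t; cases u) auto
  qed
  show "0 * a = 0" "a * 0 = 0"
    by (cases a; simp add: zero_symtrop_def)+
  show "(0 :: symtrop) \<noteq> 1"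
    by (simp add: zero_symtrop_def one_symtrop_def)
qed

definition tpos :: "symtrop set" where
  "tpos = range (TNum Plus)"

definition tneg :: "symtrop set" where
  "tneg = range (TNum Minus)"

definition tnonneg :: "symtrop set" where
  "tnonneg = tpos \<union> {0}"

definition tsigned :: "symtrop set" where
  "tsigned = tpos \<union> tneg \<union> {0}"

definition tbalanced :: "symtrop set" where
  "tbalanced = range (TNum Balanced) \<union> {0}"

text \<open>The norm \<open>|x|\<close>, as an element of \<open>tnonneg\<close>.\<close>

fun tnorm :: "symtrop \<Rightarrow> symtrop" where
  "tnorm TZero = TZero"
| "tnorm (TNum s r) = TNum Plus r"

text \<open>The order is meaningful only for arguments in \<open>tsigned\<close>.\<close>

definition tless :: "symtrop \<Rightarrow> symtrop \<Rightarrow> bool" where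
  "tless y x \<longleftrightarrow> x + (- y) \<in> tpos"

definition tle :: "symtrop \<Rightarrow> symtrop \<Rightarrow> bool" where
  "tle y x \<longleftrightarrow> tless y x \<or> y = x"

definition signed_space :: "(symtrop ^ 'd::finite) set" where
  "signed_space = {x. \<forall>i. x $ i \<in> tsigned}"

definition affine_form :: "symtrop \<Rightarrow> symtrop ^ 'd::finite \<Rightarrow> symtrop ^ 'd \<Rightarrow> symtrop" where
  "affine_form a\<^sub>0 a x = a\<^sub>0 + (\<Sum>i\<in>UNIV. a $ i * x $ i)"

text \<open>
  The coefficient vector \<open>(a\<^sub>0, a\<^sub>1, \<dots>, a\<^sub>d)\<close> is passed as the constant term \<open>a\<^sub>0\<close>
  and the vector \<open>a = (a\<^sub>1, \<dots>, a\<^sub>d)\<close>.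
\<close>

definition is_coeffs :: "symtrop \<Rightarrow> symtrop ^ 'd::finite \<Rightarrow> bool" where
  "is_coeffs a\<^sub>0 a \<longleftrightarrow> a\<^sub>0 \<in> tsigned \<and> a \<in> signed_space \<and> a \<noteq> 0"

definition hyperplane :: "symtrop \<Rightarrow> symtrop ^ 'd::finite \<Rightarrow> (symtrop ^ 'd) set" where
  "hyperplane a\<^sub>0 a = {x \<in> signed_space. affine_form a\<^sub>0 a x \<in> tbalanced}"

definition closed_halfspace_pos :: "symtrop \<Rightarrow> symtrop ^ 'd::finite \<Rightarrow> (symtrop ^ 'd) set" where
  "closed_halfspace_pos a\<^sub>0 a = {x \<in> signed_space. affine_form a\<^sub>0 a x \<in> tpos \<union> tbalanced}"

definition closed_halfspace_neg :: "symtrop \<Rightarrow> symtrop ^ 'd::finite \<Rightarrow> (symtrop ^ 'd) set" where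
  "closed_halfspace_neg a\<^sub>0 a = closed_halfspace_pos (- a\<^sub>0) (- a)"

text \<open>The set \<open>\<U>(s)\<close> of signed numbers represented by \<open>s\<close>.\<close>

definition uncomp :: "symtrop \<Rightarrow> symtrop set" where
  "uncomp s =
     (if s \<in> tbalanced then {x \<in> tsigned. tle (- tnorm s) x \<and> tle x (tnorm s)} else {s})"

definition uncomp_vec :: "symtrop ^ 'd::finite \<Rightarrow> (symtrop ^ 'd) set" where
  "uncomp_vec s = {x. \<forall>i. x $ i \<in> uncomp (s $ i)}"

text \<open>Intended for finite \<open>T\<close> only (a sum over an infinite set is \<open>0\<close> by convention).\<close>

definition conv_TO :: "(symtrop ^ 'd::finite) set \<Rightarrow> (symtrop ^ 'd) set" where
  "conv_TO T =
     \<Union> {uncomp_vec (\<Sum>v\<in>T. c v *s v) | c. (\<forall>v\<in>T. c v \<in> tnonneg) \<and> (\<Sum>v\<in>T. c v) = 1}"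

definition TO_convex :: "(symtrop ^ 'd::finite) set \<Rightarrow> bool" where
  "TO_convex M \<longleftrightarrow>
     M \<subseteq> signed_space \<and> (\<forall>T. finite T \<and> T \<subseteq> M \<longrightarrow> conv_TO T \<subseteq> M)"

lemma uminus_symtrop_add: "- (x + y) = - x + - (y :: symtrop)"
proof (cases "x = TZero \<or> y = TZero")
  case True
  then show ?thesis by (cases x; cases y) auto
next
  case False
  then obtain s p t q where "x = TNum s p" "y = TNum t q"
    by (metis symtrop.exhaust)
  then show ?thesis by (cases s; cases t) auto
qed

lemma uminus_symtrop_mult: "- x * y = - (x * (y :: symtrop))"
  by (cases x; cases y) (auto simp: sign_mult_assoc)

lemma tless_total:
  assumes "x \<in> tsigned" "y \<in> tsigned"
  shows "tless x y \<or> x = y \<or> tless y x"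
  using assms
  by (auto simp: tless_def tsigned_def tpos_def tneg_def zero_symtrop_def image_iff
      split: if_splits)

lemma affine_form_uminus: "affine_form (- a\<^sub>0) (- a) x = - affine_form a\<^sub>0 a x"
proof -
  have "- (\<Sum>i\<in>I. f i) = (\<Sum>i\<in>I. - f i)" if "finite I" for f :: "'a \<Rightarrow> symtrop" and I
    using that
    by (induction I rule: finite_induct)
      (simp_all add: uminus_symtrop_add, simp add: zero_symtrop_def)
  then show ?thesis
    by (simp add: affine_form_def uminus_symtrop_add uminus_symtrop_mult)
qed

lemma hyperplane_eq_Int:
  "hyperplane a\<^sub>0 a = closed_halfspace_pos a\<^sub>0 a \<inter> closed_halfspace_neg a\<^sub>0 a"
proof -
  have "s \<in> tbalanced \<longleftrightarrow> s \<in> tpos \<union> tbalanced \<and> - s \<in> tpos \<union> tbalanced" for s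
  proof (cases s)
    case (TNum t r)
    then show ?thesis
      by (cases t) (auto simp: tpos_def tbalanced_def zero_symtrop_def)
  qed (auto simp: tpos_def tbalanced_def zero_symtrop_def)
  then show ?thesis
    unfolding hyperplane_def closed_halfspace_neg_def closed_halfspace_pos_def affine_form_uminus
    by blast
qed

end

theory Submission
  imports Defs
begin

text \<open>
  The signed tropical numbers are identified with the reals by sending a number of sign \<open>\<plusminus>\<close> and
  norm \<open>r\<close> to \<open>\<plusminus> exp r\<close>; this respects multiplication, and a tropical sum of signed numbers is
  positive or balanced iff the corresponding real family has a nonnegative member that is largest
  in absolute value. After homogenization (with the points of \<open>Y\<close> negated) the theorem asks for one vector
  \<open>a\<close> making all families \<open>(a\<^sub>k z\<^sub>k)\<^sub>k\<close> of this kind. These conditions are closed in \<open>a\<close>, so by compactness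
  of the unit sphere it suffices to treat finitely many points. For those, raise all
  entries to the odd power \<open>2n + 1\<close>: for each \<open>n\<close>, either a real hyperplane separates the powers
  from the origin, or the origin is a convex combination of them. Taking \<open>(2n + 1)\<close>-th roots and the limit
  \<open>n \<rightarrow> \<infinity>\<close> along a subsequence, the first case yields \<open>a\<close>, and the second yields a balanced
  tropical combination, that is, a point common to \<open>X\<close> and \<open>Y\<close>.
\<close>

section \<open>Sums of odd powers and their limits\<close>

definition leading_nonneg :: "'k set \<Rightarrow> ('k \<Rightarrow> real) \<Rightarrow> bool" where
  "leading_nonneg K c \<longleftrightarrow> (\<exists>k\<in>K. \<forall>l\<in>K. \<bar>c l\<bar> \<le> c k)"

text \<open>If every limit \<open>C k\<close> were below \<open>B\<close>, numbers r < s would fit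
  between these limits and \<open>B\<close>. Eventually the sum is at most \<open>card K\<close>
  times the m-th power of r, while the left-hand side is at least the m-th power of s. As m grows,
  the powers of r/s beat the constant \<open>card K\<close>.\<close>

lemma power_sum_limit_bound:
  fixes c :: "nat \<Rightarrow> 'k \<Rightarrow> real" and b :: "nat \<Rightarrow> real" and e :: "nat \<Rightarrow> nat"
  assumes fin: "finite K"
    and e: "strict_mono e"
    and lim_c: "\<And>k. k \<in> K \<Longrightarrow> (\<lambda>n. c n k) \<longlonglongrightarrow> C k"
    and lim_b: "b \<longlonglongrightarrow> B" and B: "0 < B"
    and le: "\<And>n. b n ^ (2 * e n + 1) \<le> (\<Sum>k\<in>K. c n k ^ (2 * e n + 1))"
  shows "\<exists>k\<in>K. B \<le> C k"
proof (rule ccontr)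
  assume "\<not> ?thesis"
  then have less: "\<And>k. k \<in> K \<Longrightarrow> C k < B" by force
  \<comment> \<open>Inserting 0 covers empty \<open>K\<close> and makes r and s positive.\<close>
  define R where "R = Max (insert 0 (C ` K))"
  have R: "0 \<le> R" "R < B" "\<And>k. k \<in> K \<Longrightarrow> C k \<le> R"
    using fin less B by (auto simp: R_def)
  obtain r where r: "R < r" "r < B" using R(2) dense by blast
  obtain s where s: "r < s" "s < B" using r(2) dense by blast
  have "0 < r" using R(1) r(1) by simp
  have ev_c: "\<forall>\<^sub>F n in sequentially. \<forall>k\<in>K. c n k < r"
    unfolding eventually_ball_finite_distrib[OF fin]
    using order_tendstoD(2)[OF lim_c] R(3) r(1) by (blast intro: le_less_trans)
  have ev_b: "\<forall>\<^sub>F n in sequentially. s < b n"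
    using lim_b s(2) by (rule order_tendstoD(1))
  have e_top: "filterlim (\<lambda>n. 2 * e n + 1) at_top sequentially"
  proof (rule filterlim_at_top_mono)
    show "filterlim (\<lambda>n. n) at_top sequentially" by (rule filterlim_ident)
    show "\<forall>\<^sub>F n in sequentially. n \<le> 2 * e n + 1"
      using seq_suble[OF e]
      by (intro always_eventually allI) (metis add.commute le_add1 mult_2 order_trans trans_le_add2)
  qed
  have "(\<lambda>n. real (card K) * (r / s) ^ n) \<longlonglongrightarrow> real (card K) * 0"
    using \<open>0 < r\<close> s(1) by (intro tendsto_mult LIMSEQ_realpow_zero) auto
  then have "(\<lambda>n. real (card K) * (r / s) ^ (2 * e n + 1)) \<longlonglongrightarrow> 0"
    using filterlim_compose[OF _ e_top] by fastforce
  then have ev_q: "\<forall>\<^sub>F n in sequentially. real (card K) * (r / s) ^ (2 * e n + 1) < 1"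
    by (rule order_tendstoD(2)) simp
  obtain n where n: "\<forall>k\<in>K. c n k < r" "s < b n"
    "real (card K) * (r / s) ^ (2 * e n + 1) < 1"
    using eventually_happens[OF eventually_conj[OF ev_c eventually_conj[OF ev_b ev_q]]] by auto
  define m where "m = 2 * e n + 1"
  have odd: "odd m" by (simp add: m_def)
  \<comment> \<open>The entries \<open>c n k\<close> may be negative; the power is still monotone
    because m is odd.\<close>
  have "(\<Sum>k\<in>K. c n k ^ m) \<le> (\<Sum>k\<in>K. r ^ m)"
    using n(1) odd by (intro sum_mono power_mono_odd) auto
  also have "\<dots> = real (card K) * r ^ m" by simp
  also have "\<dots> < s ^ m"
    using n(3) \<open>0 < r\<close> s(1) unfolding m_def[symmetric] by (simp add: power_divide field_simps)
  also have "\<dots> \<le> b n ^ m"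
    using n(2) \<open>0 < r\<close> s(1) by (intro power_mono) auto
  finally show False using le[of n] by (simp add: m_def)
qed

text \<open>Otherwise some \<open>- C l\<close> is positive and exceeds every \<open>C k\<close>.
  Moving the \<open>l\<close>-th power to the other side, where the odd exponent makes it a power of
  \<open>- c n l\<close>, contradicts the preceding bound.\<close>

lemma power_sum_limit_leading_nonneg:
  fixes c :: "nat \<Rightarrow> 'k \<Rightarrow> real" and e :: "nat \<Rightarrow> nat"
  assumes fin: "finite K" and ne: "K \<noteq> {}"
    and e: "strict_mono e"
    and lim: "\<And>k. k \<in> K \<Longrightarrow> (\<lambda>n. c n k) \<longlonglongrightarrow> C k"
    and nonneg: "\<And>n. 0 \<le> (\<Sum>k\<in>K. c n k ^ (2 * e n + 1))"
  shows "leading_nonneg K C"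
proof (rule ccontr)
  assume neg: "\<not> leading_nonneg K C"
  obtain m where m: "m \<in> K" "\<And>k. k \<in> K \<Longrightarrow> C k \<le> C m"
    using obtains_MAX[OF fin ne, of C] fin by (metis Max_ge finite_imageI imageI)
  then obtain l where l: "l \<in> K" "C m < \<bar>C l\<bar>"
    using neg unfolding leading_nonneg_def by force
  then have Cl: "C m < - C l" "0 < - C l" using m(2)[OF l(1)] m(2)[OF m(1)] by linarith+
  have "\<exists>k\<in>K - {l}. - C l \<le> C k"
  proof (rule power_sum_limit_bound[where c = c and b = "\<lambda>n. - c n l" and e = e])
    show "(- c n l) ^ (2 * e n + 1) \<le> (\<Sum>k\<in>K - {l}. c n k ^ (2 * e n + 1))" for n
      using nonneg[of n] sum.remove[OF fin l(1), of "\<lambda>k. c n k ^ (2 * e n + 1)"] by simp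
  qed (use fin e lim l Cl in \<open>auto intro: tendsto_minus\<close>)
  then show False using Cl m(2) by force
qed

section \<open>A tropical version of Gordan's theorem\<close>

text \<open>Weights belong to indices, not points, since \<open>z\<close> need not be injective and
  the alternative below asks for one weight per index.\<close>

lemma convex_hull_indexed_finite:
  fixes z :: "'j \<Rightarrow> 'a::real_vector"
  assumes "finite J" and "x \<in> convex hull (z ` J)"
  shows "\<exists>u. (\<forall>j\<in>J. 0 \<le> u j) \<and> sum u J = (1::real) \<and> (\<Sum>j\<in>J. u j *\<^sub>R z j) = x"
proof -
  define S where "S = {\<Sum>j\<in>J. u j *\<^sub>R z j | u. (\<forall>j\<in>J. 0 \<le> u j) \<and> sum u J = (1::real)}"
  have "convex S"
  proof (rule convexI)
    fix x y and p q :: real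
    assume "x \<in> S" "y \<in> S" and pq: "0 \<le> p" "0 \<le> q" "p + q = 1"
    then obtain u v where u: "\<forall>j\<in>J. 0 \<le> u j" "sum u J = 1" "x = (\<Sum>j\<in>J. u j *\<^sub>R z j)"
      and v: "\<forall>j\<in>J. 0 \<le> v j" "sum v J = 1" "y = (\<Sum>j\<in>J. v j *\<^sub>R z j)"
      by (auto simp: S_def)
    have "p *\<^sub>R x + q *\<^sub>R y = (\<Sum>j\<in>J. (p * u j + q * v j) *\<^sub>R z j)"
      by (simp add: u v scaleR_sum_right scaleR_add_left sum.distrib)
    moreover have "(\<Sum>j\<in>J. p * u j + q * v j) = 1"
      using u(2) v(2) pq(3) by (simp add: sum.distrib flip: sum_distrib_left)
    ultimately show "p *\<^sub>R x + q *\<^sub>R y \<in> S"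
      using u(1) v(1) pq unfolding S_def by force
  qed
  moreover have "z ` J \<subseteq> S"
  proof
    fix y assume "y \<in> z ` J"
    then obtain i where i: "i \<in> J" "y = z i" by auto
    have "(\<Sum>j\<in>J. (if j = i then 1 else 0) *\<^sub>R z j) = y"
      using i assms(1) by (simp add: if_distrib[of "\<lambda>r. r *\<^sub>R _"] cong: if_cong)
    then show "y \<in> S"
      unfolding S_def using i assms(1) by (intro CollectI exI[of _ "\<lambda>j. if j = i then 1 else 0"]) auto
  qed
  ultimately have "convex hull (z ` J) \<subseteq> S" by (simp add: hull_minimal)
  then show ?thesis using assms(2) by (auto simp: S_def)
qed

lemma bounded_finite_family_subseq:
  fixes f :: "nat \<Rightarrow> 'j \<Rightarrow> real"
  assumes "finite J" and "\<And>n j. j \<in> J \<Longrightarrow> \<bar>f n j\<bar> \<le> B"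
  shows "\<exists>(r :: nat \<Rightarrow> nat) L. strict_mono r \<and> (\<forall>j\<in>J. (\<lambda>n. f (r n) j) \<longlonglongrightarrow> L j)"
  using assms
proof (induction J rule: finite_induct)
  case empty
  then show ?case using strict_mono_id by blast
next
  case (insert i J)
  then obtain r L where r: "strict_mono r" "\<forall>j\<in>J. (\<lambda>n. f (r n) j) \<longlonglongrightarrow> L j" by auto
  have "bounded (range (\<lambda>n. f (r n) i))"
    using insert.prems[of i] by (auto simp: bounded_iff)
  then obtain l s where s: "strict_mono s" "((\<lambda>n. f (r n) i) \<circ> s) \<longlonglongrightarrow> l"
    using bounded_imp_convergent_subsequence by blast
  have "(\<lambda>n. f (r (s n)) j) \<longlonglongrightarrow> (L(i := l)) j" if "j \<in> insert i J" for j
  proof (cases "j = i")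
    case True
    then show ?thesis using s(2) by (simp add: o_def)
  next
    case False
    then show ?thesis
      using that r(2) LIMSEQ_subseq_LIMSEQ[OF _ s(1), of "\<lambda>n. f (r n) j" "L j"] by (simp add: o_def)
  qed
  then have "\<forall>j\<in>insert i J. (\<lambda>n. f ((r \<circ> s) n) j) \<longlonglongrightarrow> (L(i := l)) j" by simp
  then show ?case using strict_mono_o[OF r(1) s(1)] by blast
qed

text \<open>This is the limit of the real Gordan alternative for the vectors \<open>zp n j\<close>.
  The excluded \<open>u\<close> is a tropical dependency: in each coordinate the largest absolute
  value is attained by a nonnegative and by a nonpositive member.\<close>

lemma tropical_gordan:
  fixes z :: "'j \<Rightarrow> real ^ 'n::finite"
  assumes fin: "finite J"
    and no_balanced: "\<And>u. \<lbrakk>\<forall>j\<in>J. 0 \<le> u j; \<exists>j\<in>J. 0 < u j;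
          \<forall>k. leading_nonneg J (\<lambda>j. u j * z j $ k) \<and> leading_nonneg J (\<lambda>j. - (u j * z j $ k))\<rbrakk> \<Longrightarrow> False"
  shows "\<exists>a. norm a = 1 \<and> (\<forall>j\<in>J. leading_nonneg UNIV (\<lambda>k. a $ k * z j $ k))"
proof -
  define zp where "zp n j = (\<chi> k. z j $ k ^ (2 * n + 1))" for n j
  define sep where "sep n \<longleftrightarrow> 0 \<notin> convex hull (zp n ` J)" for n
  show ?thesis
  proof (cases "infinite {n. sep n}")
    case True
    define e where "e = enumerate {n. sep n}"
    have e: "strict_mono e" "\<And>n. sep (e n)"
      using True enumerate_in_set[OF True] by (auto simp: e_def strict_mono_enumerate)
    have "\<exists>a. norm a = 1 \<and> (\<forall>j\<in>J. 0 \<le> (\<Sum>k\<in>UNIV. (a $ k * z j $ k) ^ (2 * e n + 1)))" for n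
    proof -
      have "compact (convex hull (zp (e n) ` J))"
        using fin by (simp add: finite_imp_compact_convex_hull)
      then obtain w \<beta> where w: "w \<noteq> 0" "0 < \<beta>" "\<And>x. x \<in> convex hull (zp (e n) ` J) \<Longrightarrow> \<beta> < inner w x"
        using separating_hyperplane_closed_0[OF convex_convex_hull compact_imp_closed] e(2)[of n]
        unfolding sep_def by (metis)
      \<comment> \<open>Odd roots exist for all reals and keep signs; with them
        \<open>inner w (zp (e n) j)\<close> becomes a sum of odd powers of
        \<open>v $ k * z j $ k\<close>.\<close>
      define v :: "real ^ 'n" where "v = (\<chi> k. root (2 * e n + 1) (w $ k))"
      have v: "v $ k ^ (2 * e n + 1) = w $ k" for k
        by (simp add: v_def odd_real_root_pow del: power_Suc)
      have "v \<noteq> 0"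
      proof
        assume "v = 0"
        then have "w $ k = 0" for k using v[of k] by simp
        then show False using w(1) by (simp add: vec_eq_iff)
      qed
      \<comment> \<open>Rescaling by a positive factor keeps the sign of the sum and puts the
        vectors on the unit sphere, where a subsequence has a nonzero limit.\<close>
      have "0 \<le> (\<Sum>k\<in>UNIV. ((v /\<^sub>R norm v) $ k * z j $ k) ^ (2 * e n + 1))" if "j \<in> J" for j
      proof -
        have "0 \<le> inner w (zp (e n) j)"
          using w(2) w(3)[of "zp (e n) j"] that by (force intro: hull_inc)
        also have "\<dots> = (\<Sum>k\<in>UNIV. (v $ k * z j $ k) ^ (2 * e n + 1))"
          unfolding inner_vec_def power_mult_distrib v by (simp add: zp_def)
        finally have "0 \<le> inverse (norm v) ^ (2 * e n + 1) * (\<Sum>k\<in>UNIV. (v $ k * z j $ k) ^ (2 * e n + 1))"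
          by (intro mult_nonneg_nonneg) auto
        then show ?thesis
          unfolding sum_distrib_left by (simp add: mult.assoc flip: power_mult_distrib del: power_Suc)
      qed
      then show ?thesis using \<open>v \<noteq> 0\<close> by (intro exI[of _ "v /\<^sub>R norm v"]) auto
    qed
    then obtain a where a: "\<And>n. norm (a n) = 1"
      "\<And>n j. j \<in> J \<Longrightarrow> 0 \<le> (\<Sum>k\<in>UNIV. (a n $ k * z j $ k) ^ (2 * e n + 1))" by metis
    obtain A s where s: "A \<in> sphere 0 1" "strict_mono s" "(a \<circ> s) \<longlonglongrightarrow> A"
      using compact_sphere[of 0 1] a(1) unfolding compact_def by (metis mem_sphere_0)
    have "leading_nonneg UNIV (\<lambda>k. A $ k * z j $ k)" if "j \<in> J" for j
    proof (rule power_sum_limit_leading_nonneg[where c = "\<lambda>n k. a (s n) $ k * z j $ k" and e = "e \<circ> s"])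
      show "strict_mono (e \<circ> s)" using e(1) s(2) by (rule strict_mono_o)
      show "(\<lambda>n. a (s n) $ k * z j $ k) \<longlonglongrightarrow> A $ k * z j $ k" for k
        using tendsto_vec_nth[OF s(3)] by (intro tendsto_mult_right) (simp add: o_def)
    qed (use a(2) that in auto)
    then show ?thesis using s(1) by auto
  next
    case False
    then obtain N where N: "\<And>n. N \<le> n \<Longrightarrow> \<not> sep n"
      by (auto simp: finite_nat_set_iff_bounded_le) (metis not_less_eq_eq)
    define e where "e n = N + n" for n
    have e: "strict_mono e" by (simp add: e_def strict_mono_def)
    have "\<exists>u. (\<forall>j\<in>J. 0 \<le> u j \<and> u j \<le> 1) \<and> (\<Sum>j\<in>J. u j ^ (2 * e n + 1)) = 1
        \<and> (\<forall>k. (\<Sum>j\<in>J. (u j * z j $ k) ^ (2 * e n + 1)) = 0)" for n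
    proof -
      obtain v where v: "\<forall>j\<in>J. 0 \<le> v j" "sum v J = (1::real)" "(\<Sum>j\<in>J. v j *\<^sub>R zp (e n) j) = 0"
        using convex_hull_indexed_finite[OF fin, of 0 "zp (e n)"] N[of "e n"]
        by (auto simp: sep_def e_def)
      define u where "u j = root (2 * e n + 1) (v j)" for j
      have u: "u j ^ (2 * e n + 1) = v j" for j
        by (simp add: u_def odd_real_root_pow del: power_Suc)
      have "v j \<le> 1" if "j \<in> J" for j
        using v(1,2) that fin member_le_sum[of j J v] by auto
      then have "\<forall>j\<in>J. 0 \<le> u j \<and> u j \<le> 1"
        using v(1) by (auto simp: u_def)
      moreover have "(\<Sum>j\<in>J. (u j * z j $ k) ^ (2 * e n + 1)) = 0" for k
        using arg_cong[OF v(3), of "\<lambda>x. x $ k"]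
        unfolding power_mult_distrib u by (simp add: zp_def)
      ultimately show ?thesis using v(2) unfolding u[symmetric] by blast
    qed
    then have "\<exists>u. \<forall>n. (\<forall>j\<in>J. 0 \<le> u n j \<and> u n j \<le> 1) \<and> (\<Sum>j\<in>J. u n j ^ (2 * e n + 1)) = 1
        \<and> (\<forall>k. (\<Sum>j\<in>J. (u n j * z j $ k) ^ (2 * e n + 1)) = 0)"
      by (intro choice allI)
    then obtain u where u: "\<And>n j. j \<in> J \<Longrightarrow> 0 \<le> u n j \<and> u n j \<le> 1"
      "\<And>n. (\<Sum>j\<in>J. u n j ^ (2 * e n + 1)) = 1"
      "\<And>n k. (\<Sum>j\<in>J. (u n j * z j $ k) ^ (2 * e n + 1)) = 0" by blast
    obtain s L where s: "strict_mono s" "\<And>j. j \<in> J \<Longrightarrow> (\<lambda>n. u (s n) j) \<longlonglongrightarrow> L j"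
      using bounded_finite_family_subseq[OF fin, of "\<lambda>n. u n" 1] u(1) by force
    have es: "strict_mono (e \<circ> s)" using e s(1) by (rule strict_mono_o)
    have "J \<noteq> {}" using u(2)[of 0] by auto
    have L0: "\<forall>j\<in>J. 0 \<le> L j"
      using s(2) u(1) by (meson LIMSEQ_le_const)
    \<comment> \<open>The convex weights are the powers of \<open>u n j\<close>, so these powers sum
      to 1. Comparing with the constant sequence 1 keeps the limit weights from all
      vanishing.\<close>
    have "\<exists>j\<in>J. 1 \<le> L j"
      using power_sum_limit_bound[OF fin es s(2), where b = "\<lambda>_. 1" and B = 1] u(2) by simp
    then have L1: "\<exists>j\<in>J. 0 < L j" by force
    have lim: "(\<lambda>n. u (s n) j * z j $ k) \<longlonglongrightarrow> L j * z j $ k" if "j \<in> J" for j k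
      using s(2)[OF that] by (rule tendsto_mult_right)
    have "leading_nonneg J (\<lambda>j. L j * z j $ k)" for k
      by (rule power_sum_limit_leading_nonneg[OF fin \<open>J \<noteq> {}\<close> es lim]) (use u(3) in auto)
    moreover have "leading_nonneg J (\<lambda>j. - (L j * z j $ k))" for k
    proof (rule power_sum_limit_leading_nonneg[OF fin \<open>J \<noteq> {}\<close> es tendsto_minus[OF lim]])
      show "0 \<le> (\<Sum>j\<in>J. (- (u (s n) j * z j $ k)) ^ (2 * (e \<circ> s) n + 1))" for n
        using u(3)[of "s n" k] by (simp add: sum_negf)
    qed
    ultimately show ?thesis using no_balanced[OF L0 L1] by blast
  qed
qed

section \<open>Translation between signed tropical numbers and reals\<close>

text \<open>The value 0 at balanced numbers is a placeholder: \<open>strop\<close> inverts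
  \<open>tval\<close> on signed numbers only.\<close>

fun tval :: "symtrop \<Rightarrow> real" where
  "tval TZero = 0"
| "tval (TNum Plus r) = exp r"
| "tval (TNum Minus r) = - exp r"
| "tval (TNum Balanced r) = 0"

definition strop :: "real \<Rightarrow> symtrop" where
  "strop x = (if x = 0 then TZero else if 0 < x then TNum Plus (ln x) else TNum Minus (ln (- x)))"

text \<open>Tropical sums may be balanced, where \<open>tval\<close> loses the norm;
  \<open>tmag\<close> keeps it on a real scale.\<close>

fun tmag :: "symtrop \<Rightarrow> real" where
  "tmag TZero = 0"
| "tmag (TNum s r) = exp r"

lemma strop_tval: "x \<in> tsigned \<Longrightarrow> strop (tval x) = x"
  by (auto simp: tsigned_def tpos_def tneg_def zero_symtrop_def strop_def)

lemma strop_tsigned [simp]: "strop x \<in> tsigned"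
  by (auto simp: tsigned_def tpos_def tneg_def zero_symtrop_def strop_def)

lemma strop_0 [simp]: "strop 0 = 0" and strop_1 [simp]: "strop 1 = 1"
  by (simp_all add: strop_def zero_symtrop_def one_symtrop_def)

lemma strop_eq_0_iff [simp]: "strop x = 0 \<longleftrightarrow> x = 0"
  by (simp add: strop_def zero_symtrop_def)

lemma strop_mult: "strop (x * y) = strop x * strop y"
  by (auto simp: strop_def zero_less_mult_iff ln_mult ln_minus)

lemma strop_minus: "strop (- x) = - strop x"
  by (simp add: strop_def)

lemma strop_tnonneg: "0 \<le> x \<Longrightarrow> strop x \<in> tnonneg"
  by (auto simp: strop_def tnonneg_def tpos_def zero_symtrop_def)

lemma tnonneg_sum: "(\<And>k. k \<in> K \<Longrightarrow> f k \<in> tnonneg) \<Longrightarrow> sum f K \<in> tnonneg"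
proof (induction K rule: infinite_finite_induct)
  case (insert i K)
  then have "f i \<in> tnonneg" "sum f K \<in> tnonneg" by auto
  then have "f i + sum f K \<in> tnonneg"
    by (cases "f i"; cases "sum f K") (auto simp: tnonneg_def tpos_def zero_symtrop_def)
  then show ?case using insert.hyps by simp
qed (simp_all add: tnonneg_def)

lemma strop_pos_or_balanced: "strop x \<in> tpos \<union> tbalanced \<longleftrightarrow> 0 \<le> x"
  by (auto simp: strop_def tpos_def tbalanced_def zero_symtrop_def)

lemma tmag_strop [simp]: "tmag (strop x) = \<bar>x\<bar>"
  by (simp add: strop_def)

lemma tmag_nonneg [simp]: "0 \<le> tmag x"
  by (cases x) auto

lemma tmag_0 [simp]: "tmag 0 = 0"
  by (simp add: zero_symtrop_def)

lemma tmag_add: "tmag (x + y) = max (tmag x) (tmag y)"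
  by (cases x; cases y) auto

text \<open>Tropical addition takes the maximum of magnitudes. Upper bounds express this without a
  maximum over a possibly empty set.\<close>

lemma tmag_sum_le_iff:
  "finite K \<Longrightarrow> 0 \<le> m \<Longrightarrow> tmag (sum f K) \<le> m \<longleftrightarrow> (\<forall>k\<in>K. tmag (f k) \<le> m)"
  by (induction K rule: finite_induct) (auto simp: tmag_add)

text \<open>The summand of larger magnitude decides the sign; on a tie the sum is negative only if
  both summands are.\<close>

lemma add_pos_or_balanced:
  "x + y \<in> tpos \<union> tbalanced \<longleftrightarrow>
    x \<in> tpos \<union> tbalanced \<and> tmag y \<le> tmag x \<or> y \<in> tpos \<union> tbalanced \<and> tmag x \<le> tmag y"
proof (cases x)
  case TZero
  then show ?thesis by (cases y) (auto simp: tpos_def tbalanced_def zero_symtrop_def)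
next
  case x: (TNum s p)
  show ?thesis
  proof (cases y)
    case TZero
    then show ?thesis using x by (auto simp: tpos_def tbalanced_def zero_symtrop_def)
  next
    case (TNum t q)
    then show ?thesis
      using x by (cases s; cases t) (auto simp: tpos_def tbalanced_def zero_symtrop_def image_iff)
  qed
qed

lemma sum_pos_or_balanced:
  assumes "finite K" "K \<noteq> {}"
  shows "sum f K \<in> tpos \<union> tbalanced \<longleftrightarrow>
    (\<exists>k\<in>K. f k \<in> tpos \<union> tbalanced \<and> (\<forall>l\<in>K. tmag (f l) \<le> tmag (f k)))"
  using assms
proof (induction K rule: finite_ne_induct)
  case (insert i K)
  define S where "S = sum f K"
  have le: "tmag S \<le> tmag (f k) \<longleftrightarrow> (\<forall>l\<in>K. tmag (f l) \<le> tmag (f k))" for k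
    unfolding S_def using insert.hyps(1) by (simp add: tmag_sum_le_iff)
  have ge: "tmag (f k) \<le> tmag S" if "k \<in> K" for k
    using tmag_sum_le_iff[OF insert.hyps(1), of "tmag S" f] that by (simp add: S_def)
  \<comment> \<open>With the magnitude of the partial sum in place of all \<open>l\<close>,
    inserting \<open>i\<close> only compares two magnitudes.\<close>
  have IH: "S \<in> tpos \<union> tbalanced \<longleftrightarrow> (\<exists>k\<in>K. f k \<in> tpos \<union> tbalanced \<and> tmag S \<le> tmag (f k))"
    unfolding le unfolding S_def by (rule insert.IH)
  have "sum f (insert i K) \<in> tpos \<union> tbalanced \<longleftrightarrow>
    f i \<in> tpos \<union> tbalanced \<and> tmag S \<le> tmag (f i) \<or> S \<in> tpos \<union> tbalanced \<and> tmag (f i) \<le> tmag S"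
    unfolding S_def sum.insert[OF insert.hyps(1,3)] by (rule add_pos_or_balanced)
  also have "\<dots> \<longleftrightarrow> (\<exists>k\<in>insert i K. f k \<in> tpos \<union> tbalanced \<and> (\<forall>l\<in>insert i K. tmag (f l) \<le> tmag (f k)))"
    unfolding IH using ge by (auto simp: le[symmetric] intro: order_trans)
  finally show ?case .
qed auto

lemma sum_strop_pos_or_balanced:
  assumes "finite K" "K \<noteq> {}"
  shows "(\<Sum>k\<in>K. strop (c k)) \<in> tpos \<union> tbalanced \<longleftrightarrow> leading_nonneg K c"
  unfolding sum_pos_or_balanced[OF assms] strop_pos_or_balanced leading_nonneg_def tmag_strop
  by (metis abs_ge_zero abs_of_nonneg order_trans)

text \<open>Splits balance into two one-sided conditions, matching \<open>leading_nonneg\<close> for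
  a family and for its negative.\<close>

lemma tbalanced_iff: "s \<in> tbalanced \<longleftrightarrow> s \<in> tpos \<union> tbalanced \<and> - s \<in> tpos \<union> tbalanced"
proof (cases s)
  case (TNum t r)
  then show ?thesis by (cases t) (auto simp: tpos_def tbalanced_def zero_symtrop_def)
qed (auto simp: tbalanced_def zero_symtrop_def)

lemma uminus_symtrop_sum: "- sum f I = (\<Sum>i\<in>I. - f i :: symtrop)"
proof (induction I rule: infinite_finite_induct)
  case (insert i I)
  then show ?case by (simp add: uminus_symtrop_add)
qed (simp_all add: zero_symtrop_def)

section \<open>Common points of tropical convex hulls\<close>

text \<open>Either both elements agree, or one is balanced and its interval contains the other, or
  both are balanced and their intervals share the tropical zero.\<close>

lemma uncomp_meet:
  assumes "s + - t \<in> tbalanced"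
  shows "\<exists>x. x \<in> uncomp s \<and> x \<in> uncomp t"
proof -
  have "s = t \<or> s \<in> tbalanced \<and> t \<in> uncomp s \<and> t \<notin> tbalanced \<or> t \<in> tbalanced \<and> s \<in> uncomp t \<and> s \<notin> tbalanced
    \<or> s \<in> tbalanced \<and> t \<in> tbalanced"
  proof (cases s)
    case TZero
    then show ?thesis using assms
      \<comment> \<open>The rule \<open>tval.cases\<close> serves only to split \<open>t\<close> by
        its sign.\<close>
      by (cases t rule: tval.cases) (auto simp: tbalanced_def zero_symtrop_def)
  next
    case s: (TNum \<sigma> p)
    show ?thesis
    proof (cases t)
      case TZero
      then show ?thesis using assms s
        by (cases \<sigma>) (auto simp: tbalanced_def zero_symtrop_def)
    next
      case (TNum \<tau> q)
      then show ?thesis using assms s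
        by (cases \<sigma>; cases \<tau>)
          (auto simp: tbalanced_def zero_symtrop_def uncomp_def tsigned_def tpos_def tneg_def
            tle_def tless_def image_iff split: if_splits)
    qed
  qed
  moreover have "TZero \<in> uncomp r" if "r \<in> tbalanced" for r
    using that by (auto simp: tbalanced_def uncomp_def tsigned_def zero_symtrop_def tle_def tless_def tpos_def)
  moreover have "\<exists>x. x \<in> uncomp r" for r
    using calculation(2) by (cases "r \<in> tbalanced") (auto simp: uncomp_def)
  moreover have "r \<in> uncomp r" if "r \<notin> tbalanced" for r
    using that by (simp add: uncomp_def)
  ultimately show ?thesis by metis
qed

text \<open>The extra coordinate \<open>None\<close> is paired with the constant term, so affine
  conditions become linear ones.\<close>

definition homog :: "symtrop ^ 'd::finite \<Rightarrow> real ^ 'd option" where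
  "homog x = (\<chi> k. case k of None \<Rightarrow> 1 | Some i \<Rightarrow> tval (x $ i))"

lemma homog_nth [simp]: "homog x $ None = 1" "homog x $ Some i = tval (x $ i)"
  by (simp_all add: homog_def)

lemma affine_form_strop:
  assumes "x \<in> signed_space"
  shows "affine_form (strop (b $ None)) (\<chi> i. strop (b $ Some i)) x =
    (\<Sum>k\<in>UNIV. strop (b $ k * homog x $ k))"
  using assms
  by (simp add: affine_form_def UNIV_option_conv sum.reindex strop_mult strop_tval signed_space_def)

text \<open>Coordinate \<open>None\<close> says that the largest weight occurs in both
  \<open>F\<close> and \<open>G\<close>, so one rescaling makes both weight families sum to the
  tropical unit. The other coordinates say that the two combinations have balanced difference, and
  \<open>uncomp_meet\<close> supplies a common point.\<close>

lemma conv_TO_meet: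
  fixes F G :: "(symtrop ^ 'd::finite) set"
  assumes fin: "finite F" "finite G" and disj: "F \<inter> G = {}"
    and signed: "F \<subseteq> signed_space" "G \<subseteq> signed_space"
    and z: "\<And>v. v \<in> F \<Longrightarrow> z v = homog v" "\<And>v. v \<in> G \<Longrightarrow> z v = - homog v"
    and u: "\<forall>v\<in>F \<union> G. 0 \<le> u v" "\<exists>v\<in>F \<union> G. 0 < u v"
    and bal: "\<And>k. leading_nonneg (F \<union> G) (\<lambda>v. u v * z v $ k)"
      "\<And>k. leading_nonneg (F \<union> G) (\<lambda>v. - (u v * z v $ k))"
  shows "conv_TO F \<inter> conv_TO G \<noteq> {}"
proof -
  obtain f where f: "f \<in> F" "\<And>v. v \<in> F \<union> G \<Longrightarrow> u v \<le> u f"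
  proof -
    \<comment> \<open>In coordinate \<open>None\<close> the family is \<open>u v\<close> on
      \<open>F\<close> and \<open>- u v\<close> on \<open>G\<close>. A nonnegative leading member in
      \<open>G\<close> would force all weights to vanish; the choice of \<open>g\<close> is
      symmetric.\<close>
    obtain v0 where v0: "v0 \<in> F \<union> G" "\<forall>v\<in>F \<union> G. \<bar>u v * z v $ None\<bar> \<le> u v0 * z v0 $ None"
      using bal(1)[of None] unfolding leading_nonneg_def by blast
    have le: "u v \<le> u v0 * z v0 $ None" if "v \<in> F \<union> G" for v
      using bspec[OF v0(2) that] that u(1) z by auto
    have "v0 \<in> F"
    proof (rule ccontr)
      assume "v0 \<notin> F"
      then have "u v \<le> 0" if "v \<in> F \<union> G" for v
        using le[OF that] bspec[OF u(1) v0(1)] v0(1) \<open>v0 \<notin> F\<close> z by auto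
      then show False using u(2) by (meson not_le)
    qed
    moreover from this have "u v \<le> u v0" if "v \<in> F \<union> G" for v
      using le[OF that] z by simp
    ultimately show ?thesis using that by blast
  qed
  obtain g where g: "g \<in> G" "\<And>v. v \<in> F \<union> G \<Longrightarrow> u v \<le> u g"
  proof -
    obtain v0 where v0: "v0 \<in> F \<union> G" "\<forall>v\<in>F \<union> G. \<bar>- (u v * z v $ None)\<bar> \<le> - (u v0 * z v0 $ None)"
      using bal(2)[of None] unfolding leading_nonneg_def by blast
    have le: "u v \<le> - (u v0 * z v0 $ None)" if "v \<in> F \<union> G" for v
      using bspec[OF v0(2) that] that u(1) z by auto
    have "v0 \<in> G"
    proof (rule ccontr)
      assume "v0 \<notin> G"
      then have "u v \<le> 0" if "v \<in> F \<union> G" for v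
        using le[OF that] bspec[OF u(1) v0(1)] v0(1) \<open>v0 \<notin> G\<close> z by auto
      then show False using u(2) by (meson not_le)
    qed
    moreover from this have "u v \<le> u v0" if "v \<in> F \<union> G" for v
      using le[OF that] z by simp
    ultimately show ?thesis using that by blast
  qed
  define m where "m = u f"
  have m: "m = u g" "0 < m" "\<And>v. v \<in> F \<union> G \<Longrightarrow> u v \<le> m"
    using f g u(2) unfolding m_def by (auto intro: antisym less_le_trans)
  define c where "c v = strop (u v / m)" for v
  have c_nonneg: "c v \<in> tnonneg" if "v \<in> F \<union> G" for v
    using that u(1) m(2) by (auto simp: c_def intro!: strop_tnonneg)
  \<comment> \<open>An element of \<open>tnonneg\<close> is determined by its magnitude, and the
    magnitude of the sum is the largest one, namely 1 at \<open>h\<close>.\<close>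
  have sum_c: "sum c H = 1" if H: "finite H" "H \<subseteq> F \<union> G" and h: "h \<in> H" "u h = m" for H h
  proof -
    have "sum c H \<in> tnonneg"
      using H(2) c_nonneg by (intro tnonneg_sum) blast
    moreover have "tmag (sum c H) = 1"
    proof (rule antisym)
      have "tmag (c v) \<le> 1" if "v \<in> H" for v
        using that H(2) m(2,3) u(1) by (auto simp: c_def)
      then show "tmag (sum c H) \<le> 1"
        using tmag_sum_le_iff[OF H(1), of 1 c] by simp
      have "1 = tmag (c h)" unfolding c_def tmag_strop h(2) using m(2) by simp
      also have "\<dots> \<le> tmag (sum c H)"
        using iffD1[OF tmag_sum_le_iff[OF H(1) tmag_nonneg] order_refl] h(1) by (rule bspec)
      finally show "1 \<le> tmag (sum c H)" .
    qed
    ultimately show ?thesis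
      by (auto simp: tnonneg_def tpos_def one_symtrop_def)
  qed
  define S where "S H = (\<Sum>v\<in>H. c v *s v)" for H
  have coord: "\<exists>x. x \<in> uncomp (S F $ i) \<and> x \<in> uncomp (S G $ i)" for i
  proof (rule uncomp_meet)
    define w where "w v = u v * z v $ Some i" for v
    have scale: "leading_nonneg K (\<lambda>v. h v / m)" if "leading_nonneg K h" for K and h :: "symtrop ^ 'd \<Rightarrow> real"
      using that m(2) by (simp add: leading_nonneg_def divide_le_cancel)
    have F: "c v * v $ i = strop (w v / m)" if "v \<in> F" for v
    proof -
      have "strop (w v / m) = c v * strop (tval (v $ i))"
        unfolding c_def strop_mult[symmetric] using that z(1) by (simp add: w_def)
      then show ?thesis using that signed(1) by (auto simp: signed_space_def strop_tval)
    qed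
    have G: "- (c v * v $ i) = strop (w v / m)" if "v \<in> G" for v
    proof -
      have "strop (w v / m) = - (c v * strop (tval (v $ i)))"
        unfolding c_def strop_mult[symmetric] strop_minus[symmetric] using that z(2) by (simp add: w_def)
      then show ?thesis using that signed(2) by (auto simp: signed_space_def strop_tval)
    qed
    \<comment> \<open>The negation in \<open>z\<close> on \<open>G\<close> absorbs the minus sign,
      so the difference is a single sum over \<open>F \<union> G\<close>.\<close>
    have eq: "S F $ i + - (S G $ i) = (\<Sum>v\<in>F \<union> G. strop (w v / m))"
      by (simp add: S_def uminus_symtrop_sum F G sum.union_disjoint[OF fin disj])
    have ne: "finite (F \<union> G)" "F \<union> G \<noteq> {}" using fin f(1) by auto
    have "(\<Sum>v\<in>F \<union> G. strop (w v / m)) \<in> tpos \<union> tbalanced"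
      unfolding sum_strop_pos_or_balanced[OF ne] w_def by (rule scale[OF bal(1)])
    moreover have "(\<Sum>v\<in>F \<union> G. strop (- w v / m)) \<in> tpos \<union> tbalanced"
      unfolding sum_strop_pos_or_balanced[OF ne] w_def by (rule scale[OF bal(2)])
    ultimately show "S F $ i + - (S G $ i) \<in> tbalanced"
      unfolding eq by (subst tbalanced_iff) (simp add: uminus_symtrop_sum strop_minus)
  qed
  then obtain x where x: "\<And>i. x i \<in> uncomp (S F $ i)" "\<And>i. x i \<in> uncomp (S G $ i)" by metis
  have "(\<chi> i. x i) \<in> conv_TO H" if "sum c H = 1" "H \<subseteq> F \<union> G" "\<And>i. x i \<in> uncomp (S H $ i)" for H
    unfolding conv_TO_def
    by (rule UnionI[of "uncomp_vec (S H)"]) (use that c_nonneg in \<open>auto simp: S_def uncomp_vec_def\<close>)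
  moreover have "sum c F = 1" using f(1) by (intro sum_c[OF fin(1)]) (auto simp: m_def)
  moreover have "sum c G = 1" using g(1) m(1) by (intro sum_c[OF fin(2)]) auto
  ultimately have "(\<chi> i. x i) \<in> conv_TO F \<inter> conv_TO G" using x by blast
  then show ?thesis by blast
qed

section \<open>Separation of arbitrary convex sets by compactness\<close>

theorem theorem6p1:
  fixes X Y :: "(symtrop ^ 'd::finite) set"
  assumes "X \<noteq> {}" and "Y \<noteq> {}"
    and "X \<inter> Y = {}"
    and "TO_convex X" and "TO_convex Y"
  shows "\<exists>a\<^sub>0 (a :: symtrop ^ 'd). is_coeffs a\<^sub>0 a \<and>
           X \<subseteq> closed_halfspace_pos a\<^sub>0 a \<and> Y \<subseteq> closed_halfspace_neg a\<^sub>0 a"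
proof -
  have signed: "X \<subseteq> signed_space" "Y \<subseteq> signed_space"
    using assms(4,5) by (auto simp: TO_convex_def)
  define z where "z v = (if v \<in> X then homog v else - homog v)" for v
  define N where "N v = {b. leading_nonneg UNIV (\<lambda>k. b $ k * z v $ k)}" for v
  have "sphere 0 1 \<inter> (\<Inter>v\<in>X \<union> Y. N v) \<noteq> {}"
  proof (rule compact_imp_fip_image)
    show "closed (N v)" for v
    proof -
      \<comment> \<open>A finite union, over the position of the leading coordinate, of sets cut out
        by weak inequalities between continuous functions.\<close>
      have "N v = (\<Union>k. \<Inter>l. {b. \<bar>b $ l * z v $ l\<bar> \<le> b $ k * z v $ k})"
        by (auto simp: N_def leading_nonneg_def)
      also have "closed \<dots>"
        by (intro closed_UN closed_INT ballI closed_Collect_le continuous_intros finite)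
      finally show ?thesis .
    qed
  next
    fix I assume I: "finite I" "I \<subseteq> X \<union> Y"
    have "\<exists>a. norm a = 1 \<and> (\<forall>v\<in>I. leading_nonneg UNIV (\<lambda>k. a $ k * z v $ k))"
    proof (rule tropical_gordan[OF I(1)])
      fix u
      assume u: "\<forall>v\<in>I. 0 \<le> u v" "\<exists>v\<in>I. 0 < u v"
        "\<forall>k. leading_nonneg I (\<lambda>v. u v * z v $ k) \<and> leading_nonneg I (\<lambda>v. - (u v * z v $ k))"
      have I_eq: "I \<inter> X \<union> I \<inter> Y = I" using I(2) by blast
      \<comment> \<open>A dependency among finitely many points yields a common point of two hulls,
        which lie in the disjoint sets \<open>X\<close> and \<open>Y\<close>.\<close>
      have "conv_TO (I \<inter> X) \<inter> conv_TO (I \<inter> Y) \<noteq> {}"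
      proof (rule conv_TO_meet[where z = z and u = u], unfold I_eq)
        show "z v = homog v" if "v \<in> I \<inter> X" for v
          using that by (simp add: z_def)
        show "z v = - homog v" if "v \<in> I \<inter> Y" for v
          using that assms(3) by (auto simp: z_def)
        show "I \<inter> X \<inter> (I \<inter> Y) = {}" "I \<inter> X \<subseteq> signed_space" "I \<inter> Y \<subseteq> signed_space"
          using assms(3) signed by blast+
      qed (use I(1) u in simp_all)
      moreover have "conv_TO (I \<inter> X) \<subseteq> X" "conv_TO (I \<inter> Y) \<subseteq> Y"
        using assms(4,5) I(1) by (auto simp: TO_convex_def)
      ultimately show False using assms(3) by blast
    qed
    then show "sphere 0 1 \<inter> (\<Inter>v\<in>I. N v) \<noteq> {}" by (force simp: N_def)
  qed simp
  then obtain b where b: "norm b = 1" "\<And>v. v \<in> X \<union> Y \<Longrightarrow> leading_nonneg UNIV (\<lambda>k. b $ k * z v $ k)"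
    unfolding N_def by (fastforce dest: bspec)
  have bX: "leading_nonneg UNIV (\<lambda>k. b $ k * homog v $ k)" if "v \<in> X" for v
    using b(2)[of v] that by (simp add: z_def)
  have bY: "leading_nonneg UNIV (\<lambda>k. - (b $ k * homog v $ k))" if "v \<in> Y" for v
  proof -
    have "v \<notin> X" using that assms(3) by blast
    then show ?thesis using b(2)[of v] that by (simp add: z_def)
  qed
  define a :: "symtrop ^ 'd" where "a = (\<chi> i. strop (b $ Some i))"
  \<comment> \<open>If only the constant term remained, a point of \<open>X\<close> would make it
    nonnegative and a point of \<open>Y\<close> nonpositive, so \<open>b\<close> would be 0 despite
    having norm 1.\<close>
  have "a \<noteq> 0"
  proof
    assume "a = 0"
    then have b0: "b $ Some i = 0" for i by (simp add: a_def vec_eq_iff)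
    \<comment> \<open>The factor \<open>t\<close> is 1 for points of \<open>X\<close> and -1 for
      points of \<open>Y\<close>.\<close>
    have b_None: "0 \<le> t * b $ None" if "leading_nonneg UNIV (\<lambda>k. t * (b $ k * homog v $ k))" for t v
    proof -
      obtain k where k: "\<bar>t * (b $ None * homog v $ None)\<bar> \<le> t * (b $ k * homog v $ k)"
        using \<open>leading_nonneg _ _\<close> unfolding leading_nonneg_def by blast
      show ?thesis
      proof (cases k)
        case None
        then show ?thesis using order_trans[OF abs_ge_zero k] by simp
      next
        case (Some i)
        then show ?thesis using k b0 by auto
      qed
    qed
    obtain x y where "x \<in> X" "y \<in> Y" using assms(1,2) by blast
    then have "b $ None = 0"
      using b_None[of 1 x] b_None[of "- 1" y] bX bY by simp
    then have "b $ k = 0" for k using b0 by (cases k) auto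
    then have "b = 0" by (simp add: vec_eq_iff)
    then show False using b(1) by simp
  qed
  then have "is_coeffs (strop (b $ None)) a"
    by (simp add: is_coeffs_def signed_space_def a_def)
  moreover have "X \<subseteq> closed_halfspace_pos (strop (b $ None)) a"
  proof
    fix x assume x: "x \<in> X"
    have "affine_form (strop (b $ None)) a x \<in> tpos \<union> tbalanced"
      unfolding a_def affine_form_strop[OF subsetD[OF signed(1) x]]
        sum_strop_pos_or_balanced[OF finite UNIV_not_empty] by (rule bX[OF x])
    then show "x \<in> closed_halfspace_pos (strop (b $ None)) a"
      using x signed(1) by (auto simp: closed_halfspace_pos_def)
  qed
  moreover have "Y \<subseteq> closed_halfspace_neg (strop (b $ None)) a"
  proof
    fix y assume y: "y \<in> Y"
    have "- affine_form (strop (b $ None)) a y \<in> tpos \<union> tbalanced"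
      unfolding a_def affine_form_strop[OF subsetD[OF signed(2) y]] uminus_symtrop_sum strop_minus[symmetric]
        sum_strop_pos_or_balanced[OF finite UNIV_not_empty] by (rule bY[OF y])
    then show "y \<in> closed_halfspace_neg (strop (b $ None)) a"
      using y signed(2) by (auto simp: closed_halfspace_neg_def closed_halfspace_pos_def affine_form_uminus)
  qed
  ultimately show ?thesis by blast
qed

end
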